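(* Let $d\ge2$ be a real number and let $K\subset\mathbb R$ be a regular Cantor set of Hausdorff dimension $s$ with $s<1-\frac2d$. Then for Lebesgue-almost every $t\in\mathbb R$, $K+t\subset D_d\subset D$.
   Context: For real $d\ge2$, $D_d$ is the set of real numbers $\alpha$ that are diophantine of order $d$, i.e. for which there is a constant $c>0$ with $|\alpha-\frac pq|>\frac c{q^d}$ for all integers $p,q$ with $q>0$. $D=\bigcup_{d\ge2}D_d$ is the set of diophantine numbers. Regular Cantor set: a Cantor set $K\subset\mathbb R$ is $C^k$-regular ($k\ge1$) if (i) there are disjoint compact intervals $I_1,\dots,I_r$ such that $K\subset I_1\cup\dots\cup I_r$ and the boundary of each $I_j$ is contained in $K$; (ii) there is a $C^k$ expanding map $\psi$ defined in a neighbourhood of $I_1\cup\dots\cup I_r$ such that each $\psi(I_j)$ is the convex hull of a finite union of some of the intervals $I_s$, for each $j$ and all sufficiently large $n$ one has $\psi^n(K\cap I_j)=K$, and $K=\bigcap_{n\in\mathbb N}\psi^{-n}(I_1\cup\dots\cup I_r)$. "Regular" means $C^k$-regular for some $k\ge 1$. For regular Cantor sets of class $C^{1+\alpha}$ it is a known theorem that the Hausdorff dimension $s$ equals the box dimension and that $\sup_{0<\epsilon\le\operatorname{diam}K}N_\epsilon(K)\epsilon^s<\infty$, where $N_\epsilon(K)$ is the minimal number of open intervals of diameter $\epsilon$ covering $K$. *)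

theory Defs
  imports "HOL-Analysis.Analysis"
begin

subsection \<open>Diophantine numbers\<close>

definition diophantine_of_order :: "real \<Rightarrow> real set" where
  "diophantine_of_order d =
     {\<alpha>. \<exists>c>0. \<forall>p q :: int. q > 0 \<longrightarrow>
        \<bar>\<alpha> - real_of_int p / real_of_int q\<bar> > c / real_of_int q powr d}"

definition diophantine_numbers :: "real set" where
  "diophantine_numbers = (\<Union>d\<in>{2..}. diophantine_of_order d)"

subsection \<open>Hausdorff measure and dimension\<close>

text \<open>The convention at \<open>s = 0\<close> is that nonempty sets have weight \<open>1\<close> (whereas \<open>0 powr 0 = 0\<close>),
  so that the \<open>0\<close>-dimensional measure is counting measure.\<close>

definition hausdorff_weight :: "real \<Rightarrow> 'a::metric_space set \<Rightarrow> ennreal" where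
  "hausdorff_weight s A =
     (if A = {} then 0 else if s = 0 then 1 else ennreal (diameter A powr s))"

text \<open>Boundedness is required explicitly because \<^const>\<open>diameter\<close> is a real number and is
  unspecified on unbounded sets.\<close>

definition hausdorff_premeasure :: "real \<Rightarrow> real \<Rightarrow> 'a::metric_space set \<Rightarrow> ennreal" where
  "hausdorff_premeasure s \<delta> A =
     (INF C \<in> {C :: nat \<Rightarrow> 'a set. A \<subseteq> (\<Union>i. C i) \<and> (\<forall>i. bounded (C i) \<and> diameter (C i) \<le> \<delta>)}.
        \<Sum>i. hausdorff_weight s (C i))"

definition hausdorff_measure :: "real \<Rightarrow> 'a::metric_space set \<Rightarrow> ennreal" where
  "hausdorff_measure s A = (SUP \<delta> \<in> {0<..}. hausdorff_premeasure s \<delta> A)"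

definition hausdorff_dim :: "'a::metric_space set \<Rightarrow> ereal" where
  "hausdorff_dim A = (INF s \<in> {s. 0 \<le> s \<and> hausdorff_measure s A = 0}. ereal s)"

subsection \<open>Regular Cantor sets\<close>

definition cantor_set :: "real set \<Rightarrow> bool" where
  "cantor_set K \<longleftrightarrow>
     K \<noteq> {} \<and> compact K \<and> (\<forall>x\<in>K. x islimpt K) \<and>
     (\<forall>C. C \<subseteq> K \<and> connected C \<longrightarrow> (\<exists>x. C \<subseteq> {x}))"

text \<open>The order \<open>k\<close> may be any nonnegative real: with \<open>n = \<lfloor>k\<rfloor>\<close>, the \<open>n\<close>-th derivative is continuous
  and locally Hoelder of exponent \<open>k - n\<close>. For integral \<open>k\<close> the last clause only says that the
  \<open>n\<close>-th derivative is locally of bounded oscillation, which follows from continuity, so this is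
  ordinary \<open>k\<close>-fold continuous differentiability. It is meant for open \<open>U\<close>.\<close>

definition Ck_on :: "real \<Rightarrow> (real \<Rightarrow> real) \<Rightarrow> real set \<Rightarrow> bool" where
  "Ck_on k f U \<longleftrightarrow>
     (let n = nat \<lfloor>k\<rfloor> in
       (\<forall>j<n. (deriv ^^ j) f differentiable_on U) \<and>
       continuous_on U ((deriv ^^ n) f) \<and>
       (\<forall>x\<in>U. \<exists>\<epsilon>>0. \<exists>B. \<forall>y\<in>U \<inter> ball x \<epsilon>. \<forall>z\<in>U \<inter> ball x \<epsilon>.
          \<bar>(deriv ^^ n) f y - (deriv ^^ n) f z\<bar> \<le> B * \<bar>y - z\<bar> powr (k - real n)))"

text \<open>The map \<open>\<psi>\<close> is only meaningful on the open neighbourhood \<open>U\<close> of the intervals. Its values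
  elsewhere play no role: since \<open>n\<close> ranges over all naturals including \<open>0\<close>, a point of the
  intersection has its whole forward orbit inside the intervals.\<close>

definition Ck_regular_cantor_set :: "real \<Rightarrow> real set \<Rightarrow> bool" where
  "Ck_regular_cantor_set k K \<longleftrightarrow>
     cantor_set K \<and>
     (\<exists>(r::nat) (I :: nat \<Rightarrow> real set) U \<psi>.
        (\<forall>j\<in>{1..r}. \<exists>a b. a \<le> b \<and> I j = {a..b}) \<and>
        disjoint_family_on I {1..r} \<and>
        K \<subseteq> (\<Union>j\<in>{1..r}. I j) \<and>
        (\<forall>j\<in>{1..r}. frontier (I j) \<subseteq> K) \<and>
        open U \<and> (\<Union>j\<in>{1..r}. I j) \<subseteq> U \<and>
        Ck_on k \<psi> U \<and>
        (\<exists>\<rho>>1. \<forall>x\<in>U. \<bar>deriv \<psi> x\<bar> \<ge> \<rho>) \<and>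
        (\<forall>j\<in>{1..r}. \<exists>S\<subseteq>{1..r}. \<psi> ` I j = convex hull (\<Union>i\<in>S. I i)) \<and>
        (\<forall>j\<in>{1..r}. \<forall>\<^sub>F n in sequentially. (\<psi> ^^ n) ` (K \<inter> I j) = K) \<and>
        K = (\<Inter>n. (\<psi> ^^ n) -` (\<Union>j\<in>{1..r}. I j)))"

definition regular_cantor_set :: "real set \<Rightarrow> bool" where
  "regular_cantor_set K \<longleftrightarrow> (\<exists>k\<ge>1. Ck_regular_cantor_set k K)"

end

(* By compactness, a set with vanishing sigma-dimensional Hausdorff measure has finite covers by
   sets V_i of diameter at most D_i with sum D_i^sigma as small as we like. A C^1 expanding map has
   almost constant logarithmic derivative at small scales, so for every theta > 0 some iterate of
   it stretches all distances in K \<inter> V_i by at least (eta / D_i)^(1 - theta), and it maps K into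
   itself. Pulling a cover of K back through these iterates gives
   N_eps(K) \<le> sum_i N_(eps / c_i)(K) with c_i = (D_i / eta)^(1 - theta), hence
   N_eps(K) = O(eps^(-s)) for s = sigma / (1 - theta), by induction on the scale. No bounded
   distortion is used, so a map that is only C^1 is allowed.

   The t in [-T, T] for which K + t meets a c / q^d-neighbourhood of some p / q then form a set of
   measure O(q (c / q^d)^(1 - s)). For s < 1 - 2 / d this is summable in q, and the sum tends to 0
   with c. *)
theory Submission
  imports Defs
begin

section \<open>Expanding C^1 maps and their distortion at small scales\<close>

lemma Ck_on_imp_C1:
  assumes "Ck_on k f U" "k \<ge> 1" "open U"
  shows "\<And>x. x \<in> U \<Longrightarrow> (f has_real_derivative deriv f x) (at x)"
    and "continuous_on U (deriv f)"
proof -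
  define n where "n = nat \<lfloor>k\<rfloor>"
  have n: "n \<ge> 1"
    unfolding n_def using assms(2) by (intro le_nat_floor) simp
  have diff: "\<And>j. j < n \<Longrightarrow> (deriv ^^ j) f differentiable_on U"
    and cont: "continuous_on U ((deriv ^^ n) f)"
    using assms(1) unfolding Ck_on_def Let_def n_def by auto
  show "(f has_real_derivative deriv f x) (at x)" if "x \<in> U" for x
  proof -
    have "f differentiable_on U"
      using diff[of 0] n by simp
    then have "f differentiable (at x)"
      using that assms(3) differentiable_on_eq_differentiable_at by blast
    then show ?thesis
      by (simp add: DERIV_deriv_iff_real_differentiable)
  qed
  \<comment> \<open>For \<open>n = 1\<close> the continuity clause is about \<open>deriv f\<close>
    itself; for larger \<open>n\<close>, \<open>deriv f\<close> is among the functions required to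
    be differentiable.\<close>
  show "continuous_on U (deriv f)"
  proof (cases "n = 1")
    case True
    then show ?thesis using cont by simp
  next
    case False
    then have "(deriv ^^ 1) f differentiable_on U"
      using n by (intro diff) simp
    then show ?thesis
      by (simp add: differentiable_imp_continuous_on)
  qed
qed

text \<open>The mean value theorem applied to \<open>min a b\<close> and \<open>max a b\<close>, so
  that the order of the two points is free. The ball around \<open>a\<close> keeps the segment
  inside \<open>U\<close>, and the closeness of \<open>z\<close> to \<open>a\<close> allows
  quotients of different pairs to be compared.\<close>

lemma difference_quotient_deriv:
  fixes f :: "real \<Rightarrow> real"
  assumes "cball a r \<subseteq> U" "\<bar>a - b\<bar> \<le> r" "a \<noteq> b"
    and deriv: "\<And>x. x \<in> U \<Longrightarrow> (f has_real_derivative f' x) (at x)"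
  obtains z where "\<bar>a - z\<bar> \<le> \<bar>a - b\<bar>" "z \<in> U" "\<bar>f a - f b\<bar> / \<bar>a - b\<bar> = \<bar>f' z\<bar>"
proof -
  have sub: "{min a b..max a b} \<subseteq> U"
  proof
    fix z assume "z \<in> {min a b..max a b}"
    then have "z \<in> cball a r"
      using assms(2) by (auto simp: dist_real_def)
    then show "z \<in> U" using assms(1) by blast
  qed
  obtain z where z: "min a b < z" "z < max a b"
      "f (max a b) - f (min a b) = (max a b - min a b) * f' z"
    using MVT2[of "min a b" "max a b" f f'] \<open>a \<noteq> b\<close> deriv sub
    by (metis atLeastAtMost_iff max_def min_def linorder_not_le nless_le subset_eq)
  have "\<bar>f a - f b\<bar> = \<bar>a - b\<bar> * \<bar>f' z\<bar>"
    using arg_cong[OF z(3), of abs] by (auto simp: abs_mult max_def min_def split: if_splits)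
  moreover have "z \<in> U" using z sub by auto
  moreover have "\<bar>a - z\<bar> \<le> \<bar>a - b\<bar>" using z by linarith
  ultimately show thesis using that[of z] \<open>a \<noteq> b\<close> by simp
qed

text \<open>Difference quotients are derivatives at nearby points, and uniform continuity makes
  these differ by a small additive error. Since \<rho> bounds the derivative below, the error
  becomes a factor \<open>\<rho> powr \<theta>\<close>, which is at most the \<theta>-th power of
  the larger quotient. This is where the exponent \<open>1 - \<theta>\<close> comes from.\<close>

lemma expanding_C1_distortion:
  fixes \<psi> :: "real \<Rightarrow> real"
  assumes "compact K" "open U" "K \<subseteq> U"
    and deriv: "\<And>x. x \<in> U \<Longrightarrow> (\<psi> has_real_derivative \<psi>' x) (at x)"
    and cont: "continuous_on U \<psi>'"
    and "\<rho> > 1" and exp: "\<And>x. x \<in> U \<Longrightarrow> \<bar>\<psi>' x\<bar> \<ge> \<rho>"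
    and \<theta>: "0 < \<theta>"
  obtains \<eta> where "\<eta> > 0"
    "\<And>a b. \<lbrakk>a \<in> K; b \<in> K; \<bar>a - b\<bar> < \<eta>\<rbrakk> \<Longrightarrow> \<rho> * \<bar>a - b\<bar> \<le> \<bar>\<psi> a - \<psi> b\<bar>"
    "\<And>a b u v. \<lbrakk>a \<in> K; b \<in> K; u \<in> K; v \<in> K; \<bar>a - b\<bar> < \<eta>; \<bar>u - v\<bar> < \<eta>; \<bar>a - u\<bar> < \<eta>;
        a \<noteq> b; u \<noteq> v\<rbrakk> \<Longrightarrow>
       (\<bar>\<psi> u - \<psi> v\<bar> / \<bar>u - v\<bar>) powr (1 - \<theta>) \<le> \<bar>\<psi> a - \<psi> b\<bar> / \<bar>a - b\<bar>"
proof -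
  obtain e where e: "e > 0" "(\<Union>x\<in>K. cball x e) \<subseteq> U"
    using compact_subset_open_imp_cball_epsilon_subset[OF assms(1-3)] by blast
  \<comment> \<open>Mean value points need not lie in \<open>K\<close>, so uniform continuity is
    used on a compact neighbourhood of \<open>K\<close>.\<close>
  define V where "V = (\<Union>x\<in>K. cball x e)"
  have "V \<subseteq> U" using e(2) unfolding V_def .
  have exp_V: "\<rho> \<le> \<bar>\<psi>' x\<bar>" if "x \<in> V" for x
    using exp that \<open>V \<subseteq> U\<close> by blast
  have "compact V"
    unfolding V_def by (intro compact_minkowski_sum_cball assms)
  then have "uniformly_continuous_on V \<psi>'"
    using cont \<open>V \<subseteq> U\<close> compact_uniformly_continuous continuous_on_subset by blast
  moreover have "\<rho> * (\<rho> powr \<theta> - 1) > 0"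
    using \<open>\<rho> > 1\<close> \<theta> by (simp add: gr_one_powr)
  ultimately obtain \<delta> where \<delta>: "\<delta> > 0"
      "\<And>x y. \<lbrakk>x \<in> V; y \<in> V; dist y x < \<delta>\<rbrakk> \<Longrightarrow> dist (\<psi>' y) (\<psi>' x) < \<rho> * (\<rho> powr \<theta> - 1)"
    unfolding uniformly_continuous_on_def by metis
  \<comment> \<open>The points \<open>w\<close> and \<open>z\<close> below are joined through
    \<open>u\<close> and \<open>a\<close>, by three distances less than \<eta> each.\<close>
  define \<eta> where "\<eta> = min e (\<delta> / 3)"
  have \<eta>: "\<eta> > 0" "\<eta> \<le> e" "3 * \<eta> \<le> \<delta>"
    using e \<delta> unfolding \<eta>_def by auto
  have quot: "\<exists>z. \<bar>a - z\<bar> < \<eta> \<and> z \<in> V \<and> \<bar>\<psi> a - \<psi> b\<bar> / \<bar>a - b\<bar> = \<bar>\<psi>' z\<bar>"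
    if "a \<in> K" "\<bar>a - b\<bar> < \<eta>" "a \<noteq> b" for a b
  proof -
    have "cball a e \<subseteq> V" using that V_def by auto
    moreover have "\<bar>a - b\<bar> \<le> e" using that \<eta> by linarith
    moreover have "\<And>x. x \<in> V \<Longrightarrow> (\<psi> has_real_derivative \<psi>' x) (at x)"
      using deriv \<open>V \<subseteq> U\<close> by blast
    ultimately obtain z where "\<bar>a - z\<bar> \<le> \<bar>a - b\<bar>" "z \<in> V" "\<bar>\<psi> a - \<psi> b\<bar> / \<bar>a - b\<bar> = \<bar>\<psi>' z\<bar>"
      using difference_quotient_deriv[OF _ _ \<open>a \<noteq> b\<close>] by blast
    then show ?thesis using that by (intro exI[of _ z]) auto
  qed
  show thesis
  proof
    show "\<eta> > 0" by fact
    show "\<rho> * \<bar>a - b\<bar> \<le> \<bar>\<psi> a - \<psi> b\<bar>" if ab: "a \<in> K" "b \<in> K" "\<bar>a - b\<bar> < \<eta>" for a b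
    proof (cases "a = b")
      case False
      then obtain z where "z \<in> V" "\<bar>\<psi> a - \<psi> b\<bar> / \<bar>a - b\<bar> = \<bar>\<psi>' z\<bar>"
        using quot[OF ab(1,3)] by blast
      then have "\<rho> \<le> \<bar>\<psi> a - \<psi> b\<bar> / \<bar>a - b\<bar>"
        using exp_V by simp
      then show ?thesis using False by (simp add: field_simps)
    qed simp
  next
    fix a b u v
    assume *: "a \<in> K" "b \<in> K" "u \<in> K" "v \<in> K" "\<bar>a - b\<bar> < \<eta>" "\<bar>u - v\<bar> < \<eta>" "\<bar>a - u\<bar> < \<eta>"
        "a \<noteq> b" "u \<noteq> v"
    obtain z where z: "\<bar>a - z\<bar> < \<eta>" "z \<in> V" "\<bar>\<psi> a - \<psi> b\<bar> / \<bar>a - b\<bar> = \<bar>\<psi>' z\<bar>"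
      using quot * by blast
    obtain w where w: "\<bar>u - w\<bar> < \<eta>" "w \<in> V" "\<bar>\<psi> u - \<psi> v\<bar> / \<bar>u - v\<bar> = \<bar>\<psi>' w\<bar>"
      using quot * by blast
    have "dist w z < \<delta>"
      using z(1) w(1) *(7) \<eta>(3) unfolding dist_real_def by linarith
    then have "\<bar>\<psi>' w\<bar> \<le> \<bar>\<psi>' z\<bar> + \<rho> * (\<rho> powr \<theta> - 1)"
      using \<delta>(2)[OF z(2) w(2)] unfolding dist_real_def by linarith
    \<comment> \<open>Here expansion turns the additive error into a multiplicative one.\<close>
    also have "\<dots> \<le> \<bar>\<psi>' z\<bar> + \<bar>\<psi>' z\<bar> * (\<rho> powr \<theta> - 1)"
      using exp_V[OF z(2)] \<open>\<rho> > 1\<close> \<theta> by (intro add_left_mono mult_right_mono) (auto simp: ge_one_powr_ge_zero)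
    finally have le: "\<bar>\<psi>' w\<bar> \<le> \<bar>\<psi>' z\<bar> * \<rho> powr \<theta>" by (simp add: algebra_simps)
    have \<rho>w: "\<rho> \<le> \<bar>\<psi>' w\<bar>" using exp_V[OF w(2)] .
    then have "\<bar>\<psi>' w\<bar> powr (1 - \<theta>) = \<bar>\<psi>' w\<bar> / \<bar>\<psi>' w\<bar> powr \<theta>"
      using \<open>\<rho> > 1\<close> by (simp add: powr_diff)
    also have "\<dots> \<le> \<bar>\<psi>' w\<bar> / \<rho> powr \<theta>"
      using \<rho>w \<open>\<rho> > 1\<close> \<theta> by (intro divide_left_mono powr_mono2 mult_pos_pos) auto
    also have "\<dots> \<le> \<bar>\<psi>' z\<bar>"
      using le \<open>\<rho> > 1\<close> by (simp add: divide_le_eq)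
    finally show "(\<bar>\<psi> u - \<psi> v\<bar> / \<bar>u - v\<bar>) powr (1 - \<theta>) \<le> \<bar>\<psi> a - \<psi> b\<bar> / \<bar>a - b\<bar>"
      using z w by simp
  qed
qed

text \<open>Iterate until, for the first time, some pair \<open>u\<close>, \<open>v\<close> of
  points of \<open>A\<close> is at distance at least \<eta>. That pair has been stretched by at
  least \<open>\<eta> / D\<close>. Before this time all images of \<open>A\<close> are small, so the
  distortion estimate applies at every step and carries the stretching over to all other pairs, at
  the price of the exponent \<open>1 - \<theta>\<close>.\<close>

lemma expanding_iterate_of_small_set:
  fixes \<psi> :: "real \<Rightarrow> real"
  assumes inv: "\<psi> ` K \<subseteq> K" and "\<rho> > 1" "\<eta> > 0" "\<theta> < 1"
    and exp: "\<And>a b. \<lbrakk>a \<in> K; b \<in> K; \<bar>a - b\<bar> < \<eta>\<rbrakk> \<Longrightarrow> \<rho> * \<bar>a - b\<bar> \<le> \<bar>\<psi> a - \<psi> b\<bar>"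
    and dist: "\<And>a b u v. \<lbrakk>a \<in> K; b \<in> K; u \<in> K; v \<in> K; \<bar>a - b\<bar> < \<eta>; \<bar>u - v\<bar> < \<eta>; \<bar>a - u\<bar> < \<eta>;
        a \<noteq> b; u \<noteq> v\<rbrakk> \<Longrightarrow>
       (\<bar>\<psi> u - \<psi> v\<bar> / \<bar>u - v\<bar>) powr (1 - \<theta>) \<le> \<bar>\<psi> a - \<psi> b\<bar> / \<bar>a - b\<bar>"
    and "A \<subseteq> K" "D > 0" and D: "\<And>a b. \<lbrakk>a \<in> A; b \<in> A\<rbrakk> \<Longrightarrow> \<bar>a - b\<bar> \<le> D"
  shows "\<exists>n. \<forall>a\<in>A. \<forall>b\<in>A. (\<eta> / D) powr (1 - \<theta>) * \<bar>a - b\<bar> \<le> \<bar>(\<psi> ^^ n) a - (\<psi> ^^ n) b\<bar>"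
proof (cases "\<exists>a\<in>A. \<exists>b\<in>A. a \<noteq> b")
  case False
  then show ?thesis by (intro exI[of _ 0]) auto
next
  case True
  then obtain a0 b0 where ab0: "a0 \<in> A" "b0 \<in> A" "a0 \<noteq> b0" by blast
  have inK: "(\<psi> ^^ n) a \<in> K" if "a \<in> A" for n a
    using that inv \<open>A \<subseteq> K\<close> by (induction n) auto
  \<comment> \<open>\<open>small n\<close> speaks of the times before \<open>n\<close> only: it is
    what the estimates for the \<open>n\<close>-th iterate need, while time \<open>n\<close> itself
    may already be the escape time.\<close>
  define small where "small n \<longleftrightarrow> (\<forall>k<n. \<forall>a\<in>A. \<forall>b\<in>A. \<bar>(\<psi> ^^ k) a - (\<psi> ^^ k) b\<bar> < \<eta>)" for n
  have grow: "\<rho> ^ n * \<bar>a - b\<bar> \<le> \<bar>(\<psi> ^^ n) a - (\<psi> ^^ n) b\<bar>" if "small n" "a \<in> A" "b \<in> A" for n a b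
    using that
  proof (induction n)
    case (Suc n)
    have "\<rho> ^ n * \<bar>a - b\<bar> \<le> \<bar>(\<psi> ^^ n) a - (\<psi> ^^ n) b\<bar>"
      using Suc unfolding small_def by auto
    then have "\<rho> ^ Suc n * \<bar>a - b\<bar> \<le> \<rho> * \<bar>(\<psi> ^^ n) a - (\<psi> ^^ n) b\<bar>"
      using \<open>\<rho> > 1\<close> by simp
    also have "\<dots> \<le> \<bar>(\<psi> ^^ Suc n) a - (\<psi> ^^ Suc n) b\<bar>"
      using exp inK Suc.prems unfolding small_def by auto
    finally show ?case .
  qed simp
  \<comment> \<open>Otherwise the distance of \<open>a0\<close> and \<open>b0\<close> would grow
    geometrically and yet stay below \<eta>.\<close>
  have "\<exists>n. \<not> small (Suc n)"
  proof (rule ccontr)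
    assume "\<not> ?thesis"
    then have "small (Suc n)" for n by blast
    then have "\<bar>(\<psi> ^^ n) a0 - (\<psi> ^^ n) b0\<bar> < \<eta>" "small n" for n
      using ab0 unfolding small_def by (meson lessI less_Suc_eq)+
    then have *: "\<rho> ^ n * \<bar>a0 - b0\<bar> < \<eta>" for n
      using grow ab0 by (meson le_less_trans)
    obtain n where "\<eta> / \<bar>a0 - b0\<bar> < \<rho> ^ n"
      using real_arch_pow \<open>\<rho> > 1\<close> by blast
    then show False using *[of n] ab0 by (simp add: field_simps)
  qed
  define n where "n = (LEAST n. \<not> small (Suc n))"
  have "\<not> small (Suc n)"
    using \<open>\<exists>n. \<not> small (Suc n)\<close> unfolding n_def by (rule LeastI_ex)
  moreover have small_n: "small n"
  proof (cases n)
    case (Suc m)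
    then show ?thesis
      using not_less_Least[of m "\<lambda>n. \<not> small (Suc n)"] unfolding n_def by simp
  qed (simp add: small_def)
  ultimately obtain u v where uv: "u \<in> A" "v \<in> A" "\<bar>(\<psi> ^^ n) u - (\<psi> ^^ n) v\<bar> \<ge> \<eta>"
    unfolding small_def by (metis less_Suc_eq not_le)
  have "u \<noteq> v" using uv \<open>\<eta> > 0\<close> by auto
  \<comment> \<open>The stretching of a pair by an iterate is the product of its one-step
    stretchings. The comparison holds factor by factor and \<open>powr\<close> is multiplicative, so
    the exponent does not deteriorate as \<open>m\<close> grows.\<close>
  have ratio: "(\<bar>(\<psi> ^^ m) u - (\<psi> ^^ m) v\<bar> / \<bar>u - v\<bar>) powr (1 - \<theta>)
      \<le> \<bar>(\<psi> ^^ m) a - (\<psi> ^^ m) b\<bar> / \<bar>a - b\<bar>"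
    if "small m" "a \<in> A" "b \<in> A" "a \<noteq> b" for m a b
    using that
  proof (induction m)
    case 0
    then show ?case using \<open>u \<noteq> v\<close> by simp
  next
    case (Suc m)
    then have "small m" unfolding small_def by auto
    define a' b' u' v' where defs: "a' = (\<psi> ^^ m) a" "b' = (\<psi> ^^ m) b" "u' = (\<psi> ^^ m) u" "v' = (\<psi> ^^ m) v"
    have pos: "0 < \<rho> ^ m * \<bar>x - y\<bar>" if "x \<noteq> y" for x y
      using that \<open>\<rho> > 1\<close> by simp
    have ne: "a' \<noteq> b'" "u' \<noteq> v'"
      using grow[OF \<open>small m\<close>, of a b] grow[OF \<open>small m\<close>, of u v] pos[of a b] pos[of u v]
        Suc.prems uv \<open>u \<noteq> v\<close> unfolding defs by auto
    have "(\<bar>(\<psi> ^^ Suc m) u - (\<psi> ^^ Suc m) v\<bar> / \<bar>u - v\<bar>) powr (1 - \<theta>)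
      = (\<bar>u' - v'\<bar> / \<bar>u - v\<bar> * (\<bar>\<psi> u' - \<psi> v'\<bar> / \<bar>u' - v'\<bar>)) powr (1 - \<theta>)"
      using ne by (simp flip: defs)
    also have "\<dots> = (\<bar>u' - v'\<bar> / \<bar>u - v\<bar>) powr (1 - \<theta>) * (\<bar>\<psi> u' - \<psi> v'\<bar> / \<bar>u' - v'\<bar>) powr (1 - \<theta>)"
      by (rule powr_mult)
    also have "\<dots> \<le> (\<bar>a' - b'\<bar> / \<bar>a - b\<bar>) * (\<bar>\<psi> a' - \<psi> b'\<bar> / \<bar>a' - b'\<bar>)"
    proof (intro mult_mono)
      show "(\<bar>u' - v'\<bar> / \<bar>u - v\<bar>) powr (1 - \<theta>) \<le> \<bar>a' - b'\<bar> / \<bar>a - b\<bar>"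
        using Suc.IH[OF \<open>small m\<close>] Suc.prems unfolding defs by simp
      show "(\<bar>\<psi> u' - \<psi> v'\<bar> / \<bar>u' - v'\<bar>) powr (1 - \<theta>) \<le> \<bar>\<psi> a' - \<psi> b'\<bar> / \<bar>a' - b'\<bar>"
        using Suc.prems uv ne inK unfolding small_def defs by (intro dist) auto
    qed auto
    also have "\<dots> = \<bar>(\<psi> ^^ Suc m) a - (\<psi> ^^ Suc m) b\<bar> / \<bar>a - b\<bar>"
      using ne by (simp flip: defs)
    finally show ?case .
  qed
  show ?thesis
  proof (intro exI[of _ n] ballI)
    fix a b assume ab: "a \<in> A" "b \<in> A"
    show "(\<eta> / D) powr (1 - \<theta>) * \<bar>a - b\<bar> \<le> \<bar>(\<psi> ^^ n) a - (\<psi> ^^ n) b\<bar>"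
    proof (cases "a = b")
      case False
      have "\<eta> / D \<le> \<bar>(\<psi> ^^ n) u - (\<psi> ^^ n) v\<bar> / \<bar>u - v\<bar>"
        using uv D[of u v] \<open>u \<noteq> v\<close> \<open>\<eta> > 0\<close> by (intro frac_le) auto
      then have "(\<eta> / D) powr (1 - \<theta>) \<le> (\<bar>(\<psi> ^^ n) u - (\<psi> ^^ n) v\<bar> / \<bar>u - v\<bar>) powr (1 - \<theta>)"
        using \<open>\<eta> > 0\<close> \<open>D > 0\<close> \<open>\<theta> < 1\<close> by (intro powr_mono2) auto
      also have "\<dots> \<le> \<bar>(\<psi> ^^ n) a - (\<psi> ^^ n) b\<bar> / \<bar>a - b\<bar>"
        using ratio small_n ab False by blast
      finally show ?thesis using False by (simp add: pos_le_divide_eq)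
    qed simp
  qed
qed

section \<open>Covering numbers under contracting pullbacks\<close>

text \<open>A cover at scale \<epsilon> is assembled from the pullbacks under \<open>g i\<close> of
  covers at the coarser scales \<open>\<epsilon> / c i\<close>. The bound
  \<open>C * \<epsilon> powr (- s)\<close> reproduces itself because the \<open>c i powr s\<close>
  add up to at most 1. Covers consist of arbitrary sets of bounded diameter, since pullbacks of
  balls need not be balls.\<close>

lemma covering_number_iterate:
  fixes K :: "'a::metric_space set" and V :: "'i \<Rightarrow> 'a set" and s :: real
  assumes "compact K" "finite F" "F \<noteq> {}" and cov: "K \<subseteq> (\<Union>i\<in>F. V i)"
    and c: "\<And>i. i \<in> F \<Longrightarrow> 0 < c i" "\<And>i. i \<in> F \<Longrightarrow> c i < 1"
    and sum: "(\<Sum>i\<in>F. c i powr s) \<le> 1" and "s \<ge> 0"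
    and g: "\<And>i. i \<in> F \<Longrightarrow> g i ` (K \<inter> V i) \<subseteq> K"
    and gc: "\<And>i x y. \<lbrakk>i \<in> F; x \<in> K \<inter> V i; y \<in> K \<inter> V i\<rbrakk> \<Longrightarrow> dist x y \<le> c i * dist (g i x) (g i y)"
  shows "\<exists>C>0. \<forall>\<epsilon>. 0 < \<epsilon> \<longrightarrow> \<epsilon> \<le> 1 \<longrightarrow>
           (\<exists>X. finite X \<and> real (card X) \<le> C * \<epsilon> powr (- s) \<and> K \<subseteq> \<Union>X \<and>
                (\<forall>S\<in>X. \<forall>x\<in>S. \<forall>y\<in>S. dist x y \<le> \<epsilon>))"
proof -
  \<comment> \<open>Below \<open>c0\<close> all coarser scales \<open>\<epsilon> / c i\<close> are
    still at most 1; passing to them raises the scale by a factor of at least \<open>1 / c1\<close>.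
    Scales from \<open>c0\<close> to 1 share the single cover \<open>X0\<close>.\<close>
  define c0 c1 where "c0 = Min (c ` F)" and "c1 = Max (c ` F)"
  have c0: "0 < c0" "\<And>i. i \<in> F \<Longrightarrow> c0 \<le> c i"
    using assms unfolding c0_def by auto
  have c1: "0 < c1" "c1 < 1" "\<And>i. i \<in> F \<Longrightarrow> c i \<le> c1"
    using assms unfolding c1_def by (auto simp: Max_gr_iff)
  obtain k where k: "finite k" "K \<subseteq> (\<Union>x\<in>k. ball x (c0 / 2))"
    using \<open>compact K\<close> c0(1) unfolding compact_eq_totally_bounded by (meson half_gt_zero)
  define X0 where "X0 = (\<lambda>x. ball x (c0 / 2)) ` k"
  \<comment> \<open>The summand 1 keeps \<open>C\<close> positive even if \<open>X0\<close> is
    empty.\<close>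
  define C where "C = real (card X0) + 1"
  have "C > 0" unfolding C_def by simp
  define P where "P \<epsilon> X \<longleftrightarrow> finite X \<and> real (card X) \<le> C * \<epsilon> powr (- s) \<and> K \<subseteq> \<Union>X \<and>
                (\<forall>S\<in>X. \<forall>x\<in>S. \<forall>y\<in>S. dist x y \<le> \<epsilon>)" for \<epsilon> X
  have base: "P \<epsilon> X0" if "c0 \<le> \<epsilon>" "\<epsilon> \<le> 1" for \<epsilon>
  proof -
    have "\<epsilon> powr 0 \<le> \<epsilon> powr (- s)"
      using that c0 \<open>s \<ge> 0\<close> by (intro powr_mono') auto
    then have "1 \<le> \<epsilon> powr (- s)" using that c0 by auto
    then have "C * 1 \<le> C * \<epsilon> powr (- s)" using \<open>C > 0\<close> by (intro mult_left_mono) auto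
    moreover have "dist x y \<le> \<epsilon>" if "x \<in> ball z (c0 / 2)" "y \<in> ball z (c0 / 2)" for x y z :: 'a
      using that \<open>c0 \<le> \<epsilon>\<close> dist_triangle2[of x y z] by (simp add: dist_commute)
    moreover have "real (card X0) \<le> C" unfolding C_def by simp
    ultimately show ?thesis
      using k unfolding P_def X0_def by auto
  qed
  \<comment> \<open>Induction on the number of factors \<open>c1\<close> that separate \<epsilon>
    from 1.\<close>
  have all: "\<exists>X. P \<epsilon> X" if "\<epsilon> \<le> 1" "c1 ^ n \<le> \<epsilon>" for n \<epsilon>
    using that
  proof (induction n arbitrary: \<epsilon>)
    case 0
    obtain i where "i \<in> F" using \<open>F \<noteq> {}\<close> by blast
    then have "c0 \<le> 1" using c0(2)[of i] c(2)[of i] by linarith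
    then show ?case using base[of \<epsilon>] 0 by auto
  next
    case (Suc n)
    show ?case
    proof (cases "c0 \<le> \<epsilon>")
      case True
      then show ?thesis using base Suc.prems by blast
    next
      case False
      have "\<epsilon> > 0" using Suc.prems c1(1) by (meson less_le_trans zero_less_power)
      have "\<exists>X. P (\<epsilon> / c i) X" if "i \<in> F" for i
      proof (rule Suc.IH)
        show "\<epsilon> / c i \<le> 1" using False c0(2)[OF that] c(1)[OF that] by simp
        have "c1 ^ n * c i \<le> c1 ^ n * c1"
          using c1 that by (intro mult_left_mono) auto
        then show "c1 ^ n \<le> \<epsilon> / c i"
          using Suc.prems c(1)[OF that] by (simp add: pos_le_divide_eq mult.commute)
      qed
      then obtain X where X: "\<And>i. i \<in> F \<Longrightarrow> P (\<epsilon> / c i) (X i)" by metis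
      define Y where "Y = (\<Union>i\<in>F. (\<lambda>S. {x \<in> K \<inter> V i. g i x \<in> S}) ` X i)"
      have "finite Y"
        using X \<open>finite F\<close> unfolding Y_def P_def by auto
      moreover have "real (card Y) \<le> C * \<epsilon> powr (- s)"
      proof -
        have "card Y \<le> (\<Sum>i\<in>F. card ((\<lambda>S. {x \<in> K \<inter> V i. g i x \<in> S}) ` X i))"
          unfolding Y_def using \<open>finite F\<close> by (rule card_UN_le)
        also have "\<dots> \<le> (\<Sum>i\<in>F. card (X i))"
          using X unfolding P_def by (intro sum_mono card_image_le) auto
        finally have "real (card Y) \<le> (\<Sum>i\<in>F. real (card (X i)))"
          by (metis of_nat_le_iff of_nat_sum)
        also have "\<dots> \<le> (\<Sum>i\<in>F. C * (\<epsilon> / c i) powr (- s))"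
          using X unfolding P_def by (intro sum_mono) auto
        also have "\<dots> = (\<Sum>i\<in>F. C * \<epsilon> powr (- s) * c i powr s)"
        proof (rule sum.cong)
          fix i assume "i \<in> F"
          then have "(\<epsilon> / c i) powr (- s) = \<epsilon> powr (- s) * c i powr s"
            using c(1)[of i] \<open>\<epsilon> > 0\<close> by (simp add: powr_divide powr_minus field_simps)
          then show "C * (\<epsilon> / c i) powr (- s) = C * \<epsilon> powr (- s) * c i powr s" by simp
        qed simp
        also have "\<dots> = C * \<epsilon> powr (- s) * (\<Sum>i\<in>F. c i powr s)"
          by (simp add: sum_distrib_left)
        also have "\<dots> \<le> C * \<epsilon> powr (- s)"
          using sum \<open>C > 0\<close> by (intro mult_right_le_one_le sum_nonneg) auto
        finally show ?thesis .
      qed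
      moreover have "K \<subseteq> \<Union>Y"
      proof
        fix x assume "x \<in> K"
        then obtain i where i: "i \<in> F" "x \<in> K \<inter> V i" using cov by auto
        then have "g i x \<in> K" using g[OF i(1)] by auto
        moreover have "K \<subseteq> \<Union>(X i)" using X[OF i(1)] unfolding P_def by simp
        ultimately obtain S where "S \<in> X i" "g i x \<in> S" by auto
        then show "x \<in> \<Union>Y" using i unfolding Y_def by auto
      qed
      moreover have "dist x y \<le> \<epsilon>" if S: "S \<in> Y" and xy: "x \<in> S" "y \<in> S" for S x y
      proof -
        obtain i S' where i: "i \<in> F" "S' \<in> X i" "S = {x \<in> K \<inter> V i. g i x \<in> S'}"
          using S unfolding Y_def by auto
        have "dist x y \<le> c i * dist (g i x) (g i y)"
          using i xy by (intro gc) auto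
        also have "\<dots> \<le> c i * (\<epsilon> / c i)"
          using X[OF i(1)] i xy c(1)[OF i(1)] unfolding P_def by (intro mult_left_mono) auto
        finally show ?thesis using c(1)[OF i(1)] by simp
      qed
      ultimately show ?thesis unfolding P_def by blast
    qed
  qed
  show ?thesis
  proof (intro exI[of _ C] conjI allI impI)
    fix \<epsilon> :: real assume "0 < \<epsilon>" "\<epsilon> \<le> 1"
    moreover obtain n where "c1 ^ n < \<epsilon>"
      using real_arch_pow_inv[OF \<open>0 < \<epsilon>\<close> c1(2)] by blast
    ultimately show "\<exists>X. finite X \<and> real (card X) \<le> C * \<epsilon> powr (- s) \<and> K \<subseteq> \<Union>X \<and>
                (\<forall>S\<in>X. \<forall>x\<in>S. \<forall>y\<in>S. dist x y \<le> \<epsilon>)"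
      using all[of \<epsilon> n] unfolding P_def by auto
  qed fact
qed

section \<open>Finite covers of compact Hausdorff null sets\<close>

text \<open>A countable cover of small total weight is thickened to an open one, and compactness
  leaves finitely many sets. One half of \<eta> is spent on the weights, the other on the
  thickening.\<close>

lemma hausdorff_null_finite_cover:
  fixes K :: "'a::metric_space set"
  assumes null: "hausdorff_measure \<sigma> K = 0" and "\<sigma> > 0" "compact K" "\<eta> > 0"
  obtains F :: "nat set" and V D where "finite F" "K \<subseteq> (\<Union>i\<in>F. V i)" "\<And>i. D i > 0"
    "\<And>i x y. \<lbrakk>x \<in> V i; y \<in> V i\<rbrakk> \<Longrightarrow> dist x y \<le> D i" "(\<Sum>i\<in>F. D i powr \<sigma>) \<le> \<eta>"
proof -
  \<comment> \<open>The scale 1 suffices: a small sum of \<sigma>-th powers forces small diameters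
    by itself.\<close>
  have "hausdorff_premeasure \<sigma> 1 K \<le> hausdorff_measure \<sigma> K"
    unfolding hausdorff_measure_def by (rule SUP_upper) simp
  then have "hausdorff_premeasure \<sigma> 1 K < ennreal (\<eta> / 2)"
    using null \<open>\<eta> > 0\<close> by simp
  then obtain B :: "nat \<Rightarrow> 'a set" where B: "K \<subseteq> (\<Union>i. B i)" "\<And>i. bounded (B i)"
      "(\<Sum>i. hausdorff_weight \<sigma> (B i)) < ennreal (\<eta> / 2)"
    unfolding hausdorff_premeasure_def INF_less_iff by auto
  \<comment> \<open>Empty sets fit the formula too, as their diameter is 0 and
    \<open>0 powr \<sigma>\<close> is 0.\<close>
  have weight: "hausdorff_weight \<sigma> (B i) = ennreal (diameter (B i) powr \<sigma>)" for i
    using \<open>\<sigma> > 0\<close> by (simp add: hausdorff_weight_def)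
  have diam: "diameter (B i) \<ge> 0" for i
    using B(2) by (rule diameter_ge_0)
  \<comment> \<open>The \<sigma>-th powers are raised by amounts with total
    \<open>\<eta> / 2\<close>. The strict gap \<open>D i - diameter (B i)\<close> makes
    \<open>D i\<close> positive and leaves room to thicken \<open>B i\<close> by half the gap on
    each side.\<close>
  define D where "D i = (diameter (B i) powr \<sigma> + \<eta> / 2 * (1 / 2) ^ Suc i) powr (1 / \<sigma>)" for i
  have D_powr: "D i powr \<sigma> = diameter (B i) powr \<sigma> + \<eta> / 2 * (1 / 2) ^ Suc i" for i
    using \<open>\<sigma> > 0\<close> \<open>\<eta> > 0\<close> unfolding D_def by (simp add: powr_powr add_nonneg_nonneg)
  have D_gt: "diameter (B i) < D i" for i
  proof (rule ccontr)
    assume "\<not> ?thesis"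
    then have "D i powr \<sigma> \<le> diameter (B i) powr \<sigma>"
      using \<open>\<sigma> > 0\<close> by (intro powr_mono2) (auto simp: D_def)
    moreover have "\<eta> / 2 * (1 / 2) ^ Suc i > 0" using \<open>\<eta> > 0\<close> by simp
    ultimately show False using D_powr[of i] by linarith
  qed
  define V where "V i = (\<Union>y\<in>B i. ball y ((D i - diameter (B i)) / 2))" for i
  have "K \<subseteq> (\<Union>i. V i)"
  proof
    fix x assume "x \<in> K"
    then obtain i where "x \<in> B i" using B(1) by auto
    then have "x \<in> V i" using D_gt[of i] unfolding V_def by (intro UN_I[of x]) auto
    then show "x \<in> (\<Union>i. V i)" by auto
  qed
  moreover have "open (V i)" for i unfolding V_def by auto
  ultimately obtain F where F: "finite F" "K \<subseteq> (\<Union>i\<in>F. V i)"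
    using compactE_image[OF \<open>compact K\<close>, of UNIV V] by auto
  show thesis
  proof
    show "finite F" "K \<subseteq> (\<Union>i\<in>F. V i)" by fact+
    show "D i > 0" for i using D_gt[of i] diam[of i] by linarith
    show "dist x y \<le> D i" if xy: "x \<in> V i" "y \<in> V i" for i x y
    proof -
      obtain u v where uv: "u \<in> B i" "v \<in> B i" "dist u x < (D i - diameter (B i)) / 2"
          "dist v y < (D i - diameter (B i)) / 2"
        using xy unfolding V_def by auto
      have "dist u v \<le> diameter (B i)"
        using B(2) uv by (intro diameter_bounded_bound)
      then show ?thesis
        using uv dist_triangle[of x y u] dist_triangle[of u y v] by (simp add: dist_commute field_simps)
    qed
    have "ennreal (\<Sum>i\<in>F. diameter (B i) powr \<sigma>) = (\<Sum>i\<in>F. hausdorff_weight \<sigma> (B i))"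
      by (simp add: weight)
    also have "\<dots> \<le> (\<Sum>i. hausdorff_weight \<sigma> (B i))"
      using F(1) by (intro sum_le_suminf) auto
    also note B(3)
    finally have "(\<Sum>i\<in>F. diameter (B i) powr \<sigma>) \<le> \<eta> / 2"
      using \<open>\<eta> > 0\<close> by (simp add: ennreal_less_iff sum_nonneg)
    moreover have "(\<Sum>i\<in>F. (1 / 2 :: real) ^ Suc i) \<le> 1"
      using sum_le_suminf[OF sums_summable[OF power_half_series] F(1)] sums_unique[OF power_half_series]
      by simp
    then have "\<eta> / 2 * (\<Sum>i\<in>F. (1 / 2) ^ Suc i) \<le> \<eta> / 2"
      using \<open>\<eta> > 0\<close> by (intro mult_right_le_one_le sum_nonneg) auto
    ultimately show "(\<Sum>i\<in>F. D i powr \<sigma>) \<le> \<eta>"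
      unfolding D_powr sum.distrib sum_distrib_left[symmetric] by linarith
  qed
qed

section \<open>The box-counting bound for regular Cantor sets\<close>

lemma regular_cantor_set_expanding_map:
  assumes "regular_cantor_set K"
  obtains U \<psi> \<rho> where "compact K" "K \<noteq> {}" "open U" "K \<subseteq> U"
    "\<And>x. x \<in> U \<Longrightarrow> (\<psi> has_real_derivative deriv \<psi> x) (at x)" "continuous_on U (deriv \<psi>)"
    "\<rho> > 1" "\<And>x. x \<in> U \<Longrightarrow> \<bar>deriv \<psi> x\<bar> \<ge> \<rho>" "\<psi> ` K \<subseteq> K"
proof -
  obtain k where "k \<ge> 1" "Ck_regular_cantor_set k K"
    using assms unfolding regular_cantor_set_def by blast
  from this(2) show thesis
    unfolding Ck_regular_cantor_set_def
  proof (elim conjE exE)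
    fix r :: nat and I :: "nat \<Rightarrow> real set" and U \<psi> \<rho>
    assume "cantor_set K" "K \<subseteq> (\<Union>j\<in>{1..r}. I j)" "open U" "(\<Union>j\<in>{1..r}. I j) \<subseteq> U"
      "Ck_on k \<psi> U" "\<rho> > 1" and exp: "\<forall>x\<in>U. \<bar>deriv \<psi> x\<bar> \<ge> \<rho>"
      and K: "K = (\<Inter>n. (\<psi> ^^ n) -` (\<Union>j\<in>{1..r}. I j))"
    have "\<psi> x \<in> K" if "x \<in> K" for x
    proof -
      \<comment> \<open>The condition on \<open>x\<close> at index \<open>Suc n\<close> is the
        condition on \<open>\<psi> x\<close> at index \<open>n\<close>.\<close>
      have "(\<psi> ^^ Suc n) x \<in> (\<Union>j\<in>{1..r}. I j)" for n
        using that unfolding K by (simp only: INT_iff UNIV_I vimage_eq ball_UNIV)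
      then show ?thesis by (subst K) (simp add: funpow_swap1)
    qed
    then have "\<psi> ` K \<subseteq> K" by blast
    moreover have "compact K" "K \<noteq> {}" using \<open>cantor_set K\<close> unfolding cantor_set_def by simp_all
    moreover have "K \<subseteq> U" using \<open>K \<subseteq> _\<close> \<open>_ \<subseteq> U\<close> by (rule subset_trans)
    ultimately show thesis
      using that[of U \<psi> \<rho>] \<open>open U\<close> \<open>\<rho> > 1\<close> exp
        Ck_on_imp_C1[OF \<open>Ck_on k \<psi> U\<close> \<open>k \<ge> 1\<close> \<open>open U\<close>] by blast
  qed
qed

text \<open>The maps \<open>g\<close> are iterates of the expanding map. It matters that \<eta>
  depends only on \<open>K\<close> and \<theta>: the cover to which this is applied is chosen after
  \<eta>.\<close>

lemma regular_cantor_set_expanding_small_sets: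
  assumes "regular_cantor_set K" "0 < \<theta>" "\<theta> < 1"
  shows "\<exists>\<eta>>0. \<forall>A D. A \<subseteq> K \<longrightarrow> D > 0 \<longrightarrow> (\<forall>a\<in>A. \<forall>b\<in>A. \<bar>a - b\<bar> \<le> D) \<longrightarrow>
           (\<exists>g. g ` K \<subseteq> K \<and> (\<forall>a\<in>A. \<forall>b\<in>A. (\<eta> / D) powr (1 - \<theta>) * \<bar>a - b\<bar> \<le> \<bar>g a - g b\<bar>))"
proof (rule regular_cantor_set_expanding_map[OF assms(1)])
  fix U \<psi> \<rho>
  assume "compact K" "open U" "K \<subseteq> U"
    and deriv: "\<And>x. x \<in> U \<Longrightarrow> (\<psi> has_real_derivative deriv \<psi> x) (at x)" "continuous_on U (deriv \<psi>)"
    and "\<rho> > 1" and exp: "\<And>x. x \<in> U \<Longrightarrow> \<bar>deriv \<psi> x\<bar> \<ge> \<rho>" and inv: "\<psi> ` K \<subseteq> K"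
  have inv_iterate: "(\<psi> ^^ n) ` K \<subseteq> K" for n
    using inv by (induction n) auto
  show ?thesis
  proof (rule expanding_C1_distortion[OF \<open>compact K\<close> \<open>open U\<close> \<open>K \<subseteq> U\<close> deriv \<open>\<rho> > 1\<close> exp assms(2)])
    fix \<eta> :: real
    assume \<eta>: "\<eta> > 0"
      "\<And>a b. \<lbrakk>a \<in> K; b \<in> K; \<bar>a - b\<bar> < \<eta>\<rbrakk> \<Longrightarrow> \<rho> * \<bar>a - b\<bar> \<le> \<bar>\<psi> a - \<psi> b\<bar>"
      "\<And>a b u v. \<lbrakk>a \<in> K; b \<in> K; u \<in> K; v \<in> K; \<bar>a - b\<bar> < \<eta>; \<bar>u - v\<bar> < \<eta>; \<bar>a - u\<bar> < \<eta>;
          a \<noteq> b; u \<noteq> v\<rbrakk> \<Longrightarrow>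
         (\<bar>\<psi> u - \<psi> v\<bar> / \<bar>u - v\<bar>) powr (1 - \<theta>) \<le> \<bar>\<psi> a - \<psi> b\<bar> / \<bar>a - b\<bar>"
    show ?thesis
    proof (intro exI[of _ \<eta>] conjI allI impI)
      fix A and D :: real
      assume "A \<subseteq> K" "D > 0" and D: "\<forall>a\<in>A. \<forall>b\<in>A. \<bar>a - b\<bar> \<le> D"
      have "\<exists>n. \<forall>a\<in>A. \<forall>b\<in>A. (\<eta> / D) powr (1 - \<theta>) * \<bar>a - b\<bar> \<le> \<bar>(\<psi> ^^ n) a - (\<psi> ^^ n) b\<bar>"
      proof (rule expanding_iterate_of_small_set[OF inv \<open>\<rho> > 1\<close> \<eta>(1) assms(3) _ _ \<open>A \<subseteq> K\<close> \<open>D > 0\<close>])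
        show "\<bar>a - b\<bar> \<le> D" if "a \<in> A" "b \<in> A" for a b
          using D that by blast
      qed (fact \<eta>(2,3))+
      then show "\<exists>g. g ` K \<subseteq> K \<and> (\<forall>a\<in>A. \<forall>b\<in>A. (\<eta> / D) powr (1 - \<theta>) * \<bar>a - b\<bar> \<le> \<bar>g a - g b\<bar>)"
        using inv_iterate by blast
    qed (fact \<eta>(1))
  qed
qed

text \<open>The gap between \<sigma> and \<open>s\<close> pays for the distortion exponent: with
  \<open>(1 - \<theta>) * s = \<sigma>\<close>, the \<open>s\<close>-th powers of the contraction
  ratios are the \<sigma>-th powers of the diameter bounds, up to the constant factor
  \<open>\<eta> powr \<sigma>\<close>.\<close>

lemma regular_cantor_set_box_bound:
  assumes "regular_cantor_set K" "hausdorff_measure \<sigma> K = 0" "0 \<le> \<sigma>" "\<sigma> < s"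
  shows "\<exists>C>0. \<forall>\<epsilon>. 0 < \<epsilon> \<longrightarrow> \<epsilon> \<le> 1 \<longrightarrow>
           (\<exists>X. finite X \<and> real (card X) \<le> C * \<epsilon> powr (- s) \<and> K \<subseteq> (\<Union>x\<in>X. cball x \<epsilon>))"
proof -
  have "compact K" "K \<noteq> {}"
    by (rule regular_cantor_set_expanding_map[OF assms(1)], assumption)+
  \<comment> \<open>The 0-dimensional measure gives weight 1 to every nonempty set, so it cannot
    vanish on \<open>K\<close>.\<close>
  have "\<sigma> > 0"
  proof (rule ccontr)
    assume "\<not> ?thesis"
    then have "\<sigma> = 0" using assms(3) by simp
    have "hausdorff_premeasure 0 1 K \<le> 0"
      using SUP_upper[of 1 "{0<..}" "\<lambda>\<delta>. hausdorff_premeasure 0 \<delta> K"] assms(2)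
      unfolding hausdorff_measure_def \<open>\<sigma> = 0\<close> by simp
    then have "hausdorff_premeasure 0 1 K < 1"
      using le_less_trans zero_less_one by blast
    then obtain B :: "nat \<Rightarrow> real set" where B: "K \<subseteq> (\<Union>i. B i)" "(\<Sum>i. hausdorff_weight 0 (B i)) < 1"
      unfolding hausdorff_premeasure_def INF_less_iff by auto
    obtain i where "B i \<noteq> {}" using B(1) \<open>K \<noteq> {}\<close> by blast
    moreover have "hausdorff_weight 0 (B i) < 1" using B(2) by (rule ennreal_suminf_lessD)
    ultimately show False by (simp add: hausdorff_weight_def)
  qed
  define \<theta> where "\<theta> = 1 - \<sigma> / s"
  have \<theta>: "0 < \<theta>" "\<theta> < 1" using \<open>\<sigma> > 0\<close> assms(4) unfolding \<theta>_def by (auto simp: field_simps)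
  have s: "s > 0" "(1 - \<theta>) * s = \<sigma>" using \<open>\<sigma> > 0\<close> assms(4) unfolding \<theta>_def by auto
  obtain \<eta> where \<eta>: "\<eta> > 0"
    "\<And>A D. \<lbrakk>A \<subseteq> K; D > 0; \<forall>a\<in>A. \<forall>b\<in>A. \<bar>a - b\<bar> \<le> D\<rbrakk> \<Longrightarrow>
       \<exists>g. g ` K \<subseteq> K \<and> (\<forall>a\<in>A. \<forall>b\<in>A. (\<eta> / D) powr (1 - \<theta>) * \<bar>a - b\<bar> \<le> \<bar>g a - g b\<bar>)"
    using regular_cantor_set_expanding_small_sets[OF assms(1) \<theta>] by metis
  \<comment> \<open>This bound on the sum makes each \<open>D i\<close> smaller than \<eta>, hence
    each ratio \<open>c i\<close> below 1, and also gives
    \<open>(\<Sum>i\<in>F. c i powr s) \<le> 1\<close>.\<close>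
  define \<tau> where "\<tau> = (\<eta> / 2) powr \<sigma>"
  have "\<tau> > 0" using \<eta>(1) unfolding \<tau>_def by simp
  obtain F :: "nat set" and V D where F: "finite F" "K \<subseteq> (\<Union>i\<in>F. V i)" "\<And>i. D i > 0"
    "\<And>i x y. \<lbrakk>x \<in> V i; y \<in> V i\<rbrakk> \<Longrightarrow> dist x y \<le> D i" "(\<Sum>i\<in>F. D i powr \<sigma>) \<le> \<tau>"
    using hausdorff_null_finite_cover[OF assms(2) \<open>\<sigma> > 0\<close> \<open>compact K\<close> \<open>\<tau> > 0\<close>] by metis
  have D_less: "D i < \<eta>" if "i \<in> F" for i
  proof (rule ccontr)
    assume "\<not> ?thesis"
    then have "\<eta> powr \<sigma> \<le> D i powr \<sigma>" using \<open>\<sigma> > 0\<close> \<eta>(1) by (intro powr_mono2) auto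
    also have "\<dots> \<le> (\<Sum>i\<in>F. D i powr \<sigma>)" using that F(1) by (intro member_le_sum) auto
    also have "\<dots> < \<eta> powr \<sigma>"
      using F(5) \<eta>(1) \<open>\<sigma> > 0\<close> powr_less_mono2[of \<sigma> "\<eta> / 2" \<eta>] unfolding \<tau>_def by simp
    finally show False by simp
  qed
  define c where "c i = (D i / \<eta>) powr (1 - \<theta>)" for i
  have "\<exists>g. g ` K \<subseteq> K \<and> (\<forall>a\<in>K \<inter> V i. \<forall>b\<in>K \<inter> V i.
      (\<eta> / D i) powr (1 - \<theta>) * \<bar>a - b\<bar> \<le> \<bar>g a - g b\<bar>)" for i
    using F(3) F(4)[of _ i] by (intro \<eta>(2)) (auto simp: dist_real_def)
  then obtain g where g: "\<And>i. g i ` K \<subseteq> K" "\<And>i a b. \<lbrakk>a \<in> K \<inter> V i; b \<in> K \<inter> V i\<rbrakk> \<Longrightarrow>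
      (\<eta> / D i) powr (1 - \<theta>) * \<bar>a - b\<bar> \<le> \<bar>g i a - g i b\<bar>"
    by metis
  have "\<exists>C>0. \<forall>\<epsilon>. 0 < \<epsilon> \<longrightarrow> \<epsilon> \<le> 1 \<longrightarrow>
           (\<exists>X. finite X \<and> real (card X) \<le> C * \<epsilon> powr (- s) \<and> K \<subseteq> \<Union>X \<and>
                (\<forall>S\<in>X. \<forall>x\<in>S. \<forall>y\<in>S. dist x y \<le> \<epsilon>))"
  proof (rule covering_number_iterate[where c = c and g = g])
    show "F \<noteq> {}" using F(2) \<open>K \<noteq> {}\<close> by auto
    show "0 < c i" for i using F(3)[of i] \<eta>(1) unfolding c_def by simp
    show "c i < 1" if "i \<in> F" for i
      using F(3)[of i] D_less[OF that] \<theta> powr_less_mono2[of "1 - \<theta>" "D i / \<eta>" 1] unfolding c_def by simp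
    have "c i powr s = D i powr \<sigma> / \<eta> powr \<sigma>" for i
      using F(3)[of i] \<eta>(1) unfolding c_def powr_powr s(2) by (simp add: powr_divide)
    then have "(\<Sum>i\<in>F. c i powr s) = (\<Sum>i\<in>F. D i powr \<sigma>) / \<eta> powr \<sigma>"
      by (simp add: sum_divide_distrib)
    moreover have "\<tau> \<le> \<eta> powr \<sigma>"
      unfolding \<tau>_def using \<eta>(1) \<open>\<sigma> > 0\<close> by (intro powr_mono2) auto
    ultimately show "(\<Sum>i\<in>F. c i powr s) \<le> 1"
      using F(5) \<eta>(1) by simp
    show "g i ` (K \<inter> V i) \<subseteq> K" for i using g(1)[of i] by blast
    show "dist x y \<le> c i * dist (g i x) (g i y)" if "x \<in> K \<inter> V i" "y \<in> K \<inter> V i" for i x y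
    proof -
      have "c i * (\<eta> / D i) powr (1 - \<theta>) = 1"
        using F(3)[of i] \<eta>(1) unfolding c_def by (simp flip: powr_mult)
      moreover have "c i \<ge> 0" unfolding c_def by simp
      ultimately show ?thesis
        using mult_left_mono[OF g(2)[OF that], of "c i"] unfolding dist_real_def
        by (simp flip: mult.assoc)
    qed
  qed (use \<open>compact K\<close> F(1,2) s(1) in auto)
  then obtain C where C: "C > 0" "\<And>\<epsilon>. \<lbrakk>0 < \<epsilon>; \<epsilon> \<le> 1\<rbrakk> \<Longrightarrow>
           (\<exists>X. finite X \<and> real (card X) \<le> C * \<epsilon> powr (- s) \<and> K \<subseteq> \<Union>X \<and>
                (\<forall>S\<in>X. \<forall>x\<in>S. \<forall>y\<in>S. dist x y \<le> \<epsilon>))"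
    by blast
  show ?thesis
  proof (intro exI[of _ C] conjI allI impI)
    fix \<epsilon> :: real assume "0 < \<epsilon>" "\<epsilon> \<le> 1"
    then obtain X where X: "finite X" "real (card X) \<le> C * \<epsilon> powr (- s)" "K \<subseteq> \<Union>X"
        "\<And>S x y. \<lbrakk>S \<in> X; x \<in> S; y \<in> S\<rbrakk> \<Longrightarrow> dist x y \<le> \<epsilon>"
      using C(2) by metis
    \<comment> \<open>Each covering set lies in the ball of radius \<epsilon> about any of its
      points; the arbitrary value for an empty set does no harm.\<close>
    define p where "p S = (SOME x. x \<in> S)" for S :: "real set"
    have "K \<subseteq> (\<Union>x\<in>p ` X. cball x \<epsilon>)"
    proof
      fix x assume "x \<in> K"
      then obtain S where S: "S \<in> X" "x \<in> S" using X(3) by blast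
      then have "p S \<in> S" unfolding p_def by (meson someI)
      then show "x \<in> (\<Union>x\<in>p ` X. cball x \<epsilon>)" using S X(4) by auto
    qed
    moreover have "real (card (p ` X)) \<le> C * \<epsilon> powr (- s)"
      using card_image_le[OF X(1), of p] X(2) by linarith
    ultimately show "\<exists>X. finite X \<and> real (card X) \<le> C * \<epsilon> powr (- s) \<and> K \<subseteq> (\<Union>x\<in>X. cball x \<epsilon>)"
      using X(1) by (intro exI[of _ "p ` X"]) auto
  qed (fact C(1))
qed

section \<open>Lebesgue measure of the exceptional translations\<close>

text \<open>If \<open>t\<close> is bad, some point of \<open>K + t\<close> violates the diophantine
  inequality for every constant \<open>c\<close>. So for each \<open>c\<close> the bounded part of
  \<open>bad\<close> is covered by intervals about the differences of a rational
  \<open>p / q\<close> and a centre from a cover of \<open>K\<close>. Their total length tends to 0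
  with \<open>c\<close>.\<close>

lemma AE_translate_diophantine:
  fixes K :: "real set"
  assumes "bounded K" "d > 0" "s < 1 - 2 / d" "C > 0"
    and box: "\<And>\<epsilon>. \<lbrakk>0 < \<epsilon>; \<epsilon> \<le> 1\<rbrakk> \<Longrightarrow>
       \<exists>X. finite X \<and> real (card X) \<le> C * \<epsilon> powr (- s) \<and> K \<subseteq> (\<Union>x\<in>X. cball x \<epsilon>)"
  shows "AE t in lebesgue. (\<lambda>x. x + t) ` K \<subseteq> diophantine_of_order d"
proof -
  define bad where "bad = {t. \<not> (\<lambda>x. x + t) ` K \<subseteq> diophantine_of_order d}"
  define h where "h = 1 - s"
  have "2 / d < h" "0 < 2 / d" using assms(2,3) unfolding h_def by auto
  \<comment> \<open>The second inequality is exactly what makes the sum of the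
    \<open>q powr (1 - d * h)\<close> converge.\<close>
  then have h: "h > 0" "d * h > 2"
    using \<open>d > 0\<close> by (linarith, simp add: pos_divide_less_eq mult.commute)
  have "negligible (bad \<inter> cball 0 (real T))" for T
    unfolding negligible_outer_le
  proof (intro allI impI)
    fix e :: real assume "e > 0"
    obtain M where M: "\<And>x. x \<in> K \<Longrightarrow> \<bar>x\<bar> \<le> M"
      using \<open>bounded K\<close> unfolding bounded_iff by auto
    \<comment> \<open>\<open>L\<close> bounds every fraction that can come within distance 1 of
      \<open>x + t\<close>, so each denominator has finitely many relevant numerators.\<close>
    obtain L :: nat where L: "M + real T + 1 \<le> real L" using real_arch_simple by blast
    \<comment> \<open>From here on the index \<open>q\<close> stands for the denominator
      \<open>Suc q\<close>.\<close>
    define z where "z q = real (Suc q) powr (1 - d * h)" for q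
    have "summable z"
      unfolding z_def using h(2) summable_real_powr_iff[of "1 - d * h"] by (subst summable_Suc_iff) simp
    define Z where "Z = (\<Sum>q. z q)"
    have "z q \<ge> 0" for q unfolding z_def by simp
    then have "Z \<ge> 0" unfolding Z_def using \<open>summable z\<close> by (intro suminf_nonneg)
    \<comment> \<open>The factors bound the numerators per unit of the denominator, the constant in
      the box bound, and the length \<open>4 * \<epsilon> q\<close> of an interval of radius
      \<open>2 * \<epsilon> q\<close>.\<close>
    define W where "W = (2 * real L + 1) * C * 4"
    have "W > 0" unfolding W_def using \<open>C > 0\<close> by simp
    \<comment> \<open>Chosen to give \<open>W * c powr h * Z \<le> e\<close>; the summand 1 keeps
      the denominator positive, and \<open>c \<le> 1\<close> ensures
      \<open>\<epsilon> q \<le> 1\<close>.\<close>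
    define c where "c = min 1 ((e / (W * Z + 1)) powr (1 / h))"
    have WZ: "W * Z + 1 > 0" using \<open>W > 0\<close> \<open>Z \<ge> 0\<close> by (simp add: add_nonneg_pos)
    have c: "0 < c" "c \<le> 1" using \<open>e > 0\<close> WZ unfolding c_def by auto
    have "c powr h \<le> ((e / (W * Z + 1)) powr (1 / h)) powr h"
      using c h(1) unfolding c_def by (intro powr_mono2) auto
    also have "\<dots> = e / (W * Z + 1)" using h(1) WZ \<open>e > 0\<close> by (simp add: powr_powr)
    finally have "c powr h * (W * Z + 1) \<le> e" using WZ by (simp add: pos_le_divide_eq)
    then have "W * c powr h * Z + c powr h \<le> e" by (simp add: algebra_simps)
    then have small: "W * c powr h * Z \<le> e" using powr_ge_zero[of c h] by linarith
    define \<epsilon> where "\<epsilon> q = c / real (Suc q) powr d" for q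
    have \<epsilon>: "0 < \<epsilon> q" "\<epsilon> q \<le> 1" for q
    proof -
      have "1 \<le> real (Suc q) powr d" using \<open>d > 0\<close> by (intro ge_one_powr_ge_zero) auto
      then show "0 < \<epsilon> q" "\<epsilon> q \<le> 1" using c unfolding \<epsilon>_def by (auto simp: divide_le_eq)
    qed
    obtain X where X: "\<And>q. finite (X q)" "\<And>q. real (card (X q)) \<le> C * \<epsilon> q powr (- s)"
        "\<And>q. K \<subseteq> (\<Union>x\<in>X q. cball x (\<epsilon> q))"
      using box[OF \<epsilon>] by metis
    define P where "P q = {- int (Suc q * L)..int (Suc q * L)}" for q
    \<comment> \<open>The radius allows one error \<open>\<epsilon> q\<close> for the approximation
      by \<open>p / q\<close> and one for replacing the point of \<open>K\<close> by a
      centre.\<close>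
    define A where "A q = (\<Union>(p, x)\<in>P q \<times> X q. cball (real_of_int p / real (Suc q) - x) (2 * \<epsilon> q))" for q
    have A: "A q \<in> lmeasurable" "measure lebesgue (A q) \<le> W * c powr h * z q" for q
    proof -
      have fin: "finite (P q \<times> X q)" using X(1) unfolding P_def by auto
      then show "A q \<in> lmeasurable"
        unfolding A_def by (intro fmeasurable.finite_UN) auto
      have "measure lebesgue (A q) \<le> (\<Sum>(p, x)\<in>P q \<times> X q.
          measure lebesgue (cball (real_of_int p / real (Suc q) - x) (2 * \<epsilon> q)))"
        using measure_UNION_le[OF fin, of "\<lambda>(p, x). cball (real_of_int p / real (Suc q) - x) (2 * \<epsilon> q)" lebesgue]
        unfolding A_def by (simp add: case_prod_unfold)
      also have "\<dots> = real (card (P q)) * real (card (X q)) * (4 * \<epsilon> q)"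
        using \<epsilon>(1)[of q] by (simp add: cball_eq_atLeastAtMost case_prod_unfold card_cartesian_product)
      also have "\<dots> \<le> ((2 * real L + 1) * real (Suc q)) * (C * \<epsilon> q powr (- s)) * (4 * \<epsilon> q)"
      proof (intro mult_right_mono mult_mono X)
        have "real (card (P q)) = 2 * (real (Suc q) * real L) + 1" unfolding P_def by (simp add: algebra_simps)
        then show "real (card (P q)) \<le> (2 * real L + 1) * real (Suc q)" by (simp add: algebra_simps)
      qed (use \<epsilon>(1)[of q] in auto)
      also have "\<dots> = W * (real (Suc q) * (\<epsilon> q powr (- s) * \<epsilon> q powr 1))"
        using \<epsilon>(1)[of q] unfolding W_def by simp
      also have "\<epsilon> q powr (- s) * \<epsilon> q powr 1 = \<epsilon> q powr h"
        unfolding h_def by (simp only: powr_add[symmetric]) simp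
      also have "\<dots> = c powr h * real (Suc q) powr (- (d * h))"
        unfolding \<epsilon>_def using c(1) by (simp add: powr_divide powr_powr powr_minus_divide)
      also have "W * (real (Suc q) * (c powr h * real (Suc q) powr (- (d * h)))) = W * c powr h * z q"
        unfolding z_def by (simp add: powr_diff powr_minus_divide)
      finally show "measure lebesgue (A q) \<le> W * c powr h * z q" .
    qed
    have bound: "measure lebesgue (\<Union>q\<in>Q. A q) \<le> e" if "finite Q" for Q
    proof -
      have "measure lebesgue (\<Union>q\<in>Q. A q) \<le> (\<Sum>q\<in>Q. measure lebesgue (A q))"
        using A(1) that by (intro measure_UNION_le) auto
      also have "\<dots> \<le> W * c powr h * (\<Sum>q\<in>Q. z q)"
        using A(2) by (simp add: sum_distrib_left sum_mono)
      also have "\<dots> \<le> W * c powr h * Z"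
        unfolding Z_def using \<open>summable z\<close> that \<open>W > 0\<close> \<open>\<And>q. z q \<ge> 0\<close>
        by (intro mult_left_mono sum_le_suminf) auto
      finally show ?thesis using small by linarith
    qed
    have "bad \<inter> cball 0 (real T) \<subseteq> (\<Union>q. A q)"
    proof
      fix t assume t: "t \<in> bad \<inter> cball 0 (real T)"
      then obtain x where x: "x \<in> K" "x + t \<notin> diophantine_of_order d"
        unfolding bad_def by auto
      then obtain p q' :: int where q': "q' > 0"
          "\<bar>x + t - real_of_int p / real_of_int q'\<bar> \<le> c / real_of_int q' powr d"
        using c(1) unfolding diophantine_of_order_def mem_Collect_eq by (meson not_less)
      define q where "q = nat q' - 1"
      have q: "real_of_int q' = real (Suc q)" using q'(1) unfolding q_def by simp
      have close: "\<bar>x + t - real_of_int p / real (Suc q)\<bar> \<le> \<epsilon> q"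
        using q'(2) unfolding q \<epsilon>_def .
      have "\<bar>t\<bar> \<le> real T" using t by simp
      then have "\<bar>real_of_int p / real (Suc q)\<bar> \<le> real L"
        using close M[OF x(1)] \<open>\<bar>t\<bar> \<le> real T\<close> L \<epsilon>(2)[of q] by linarith
      then have "\<bar>real_of_int p\<bar> \<le> real (Suc q * L)"
        by (simp add: abs_divide pos_divide_le_eq mult.commute distrib_left)
      then have "\<bar>p\<bar> \<le> int (Suc q * L)" by (metis of_int_abs of_int_le_iff of_int_of_nat_eq)
      then have "p \<in> P q" unfolding P_def atLeastAtMost_iff by linarith
      moreover obtain y where y: "y \<in> X q" "x \<in> cball y (\<epsilon> q)" using X(3) x(1) by blast
      moreover have "t \<in> cball (real_of_int p / real (Suc q) - y) (2 * \<epsilon> q)"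
        using close y(2) unfolding mem_cball dist_real_def by linarith
      ultimately show "t \<in> (\<Union>q. A q)" unfolding A_def by blast
    qed
    moreover have "(\<Union>q. A q) \<in> lmeasurable"
      by (rule fmeasurable_UN_bound[where B = e]) (simp_all only: A(1) bound countableI_type)
    moreover have "measure lebesgue (\<Union>q. A q) \<le> e"
      by (rule measure_UN_bound) (simp_all only: A(1) bound countableI_type)
    ultimately show "\<exists>S. bad \<inter> cball 0 (real T) \<subseteq> S \<and> S \<in> lmeasurable \<and> measure lebesgue S \<le> e"
      by blast
  qed
  then have "negligible (\<Union>T. bad \<inter> cball 0 (real T))" by (intro negligible_countable_Union) auto
  moreover have "(\<Union>T. bad \<inter> cball 0 (real T)) = bad"
    using real_arch_simple by auto
  ultimately have "bad \<in> null_sets lebesgue" by (simp only: negligible_iff_null_sets)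
  then show ?thesis
    by (rule AE_I') (auto simp: bad_def)
qed

theorem theorem0p6:
  fixes d s :: real and K :: "real set"
  assumes "d \<ge> 2"
    and "regular_cantor_set K"
    and "hausdorff_dim K = ereal s"
    and "s < 1 - 2 / d"
  shows "AE t in lebesgue.
           (\<lambda>x. x + t) ` K \<subseteq> diophantine_of_order d \<and>
           diophantine_of_order d \<subseteq> diophantine_numbers"
proof -
  \<comment> \<open>The dimension is an infimum, so the null measure is obtained at some \<sigma>
    below the threshold; a further exponent \<open>s'\<close> in between absorbs the loss in the box
    bound.\<close>
  have "hausdorff_dim K < ereal (1 - 2 / d)" using assms(3,4) by simp
  then obtain \<sigma> where \<sigma>: "0 \<le> \<sigma>" "hausdorff_measure \<sigma> K = 0" "\<sigma> < 1 - 2 / d"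
    unfolding hausdorff_dim_def INF_less_iff by auto
  obtain s' where s': "\<sigma> < s'" "s' < 1 - 2 / d" using dense[OF \<sigma>(3)] by blast
  have "bounded K"
    by (rule regular_cantor_set_expanding_map[OF assms(2)]) (rule compact_imp_bounded)
  obtain C where "C > 0" "\<forall>\<epsilon>. 0 < \<epsilon> \<longrightarrow> \<epsilon> \<le> 1 \<longrightarrow>
      (\<exists>X. finite X \<and> real (card X) \<le> C * \<epsilon> powr (- s') \<and> K \<subseteq> (\<Union>x\<in>X. cball x \<epsilon>))"
    using regular_cantor_set_box_bound[OF assms(2) \<sigma>(2,1) s'(1)] by (elim exE conjE)
  then have "AE t in lebesgue. (\<lambda>x. x + t) ` K \<subseteq> diophantine_of_order d"
    using assms(1) by (intro AE_translate_diophantine[OF \<open>bounded K\<close> _ s'(2)]) auto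
  moreover have "diophantine_of_order d \<subseteq> diophantine_numbers"
    using assms(1) unfolding diophantine_numbers_def by blast
  ultimately show ?thesis by simp
qed

end
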